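(* Let $(G_1, G_2) \sim \mathbb{G}(n,1/2)^{\otimes 2}$ be two independent Erdős–Rényi random graphs, and let $(H_1, H_2, \pi)$ denote the output of $\textsc{Greedy}(G_1, G_2)$ (described in the context). Then $(H_1, H_2)$ is a solution to the largest common induced subgraph problem on $(G_1,G_2)$ (i.e., $H_1$ and $H_2$ are induced subgraphs of $G_1$ and $G_2$ with $H_1 \cong H_2$) and $\pi$ is a graph isomorphism between $H_1$ and $H_2$. Furthermore, for any $\varepsilon > 0$ and for all $n$ large enough, the number of vertices of $H_1$ (equivalently of $H_2$) is at least $(2 - \varepsilon)\log_2 n$ with probability at least $1 - \exp(-n^{\varepsilon / 4})$.
   Context: $\mathbb{G}(n,1/2)$ is the Erdős–Rényi random graph on vertex set $[n]=\{1,\dots,n\}$ where each pair is an edge independently with probability $1/2$. A solution $(H_1,H_2)$ for a pair of graphs $(G_1,G_2)$ is a pair of induced subgraphs $H_1\subseteq G_1$, $H_2\subseteq G_2$ with $H_1\cong H_2$; its size is $|V(H_1)|=|V(H_2)|$. The algorithm $\textsc{Greedy}(G_1,G_2)$: fix arbitrary orderings $u_1,\dots,u_n$ of $V(G_1)$ and $v_1,\dots,v_n$ of $V(G_2)$; initialize $S_1=S_2=\emptyset$ and $\pi:S_1\to S_2$ the empty map. For $i=1,\dots,n$: for $j=1,2,\dots,i$ in order, until a pair has been added in this iteration $i$: if $v_j\notin S_2$ and $u_i$ has identical connections to $v_j$ (meaning: for all $u'\in S_1$, $(u_i,u')\in E(G_1)\iff(v_j,\pi(u'))\in E(G_2)$),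 then add $u_i$ to $S_1$, $v_j$ to $S_2$, set $\pi(u_i):=v_j$ and stop iteration $i$; else if $u_j\notin S_1$ and $u_j,v_i$ have identical connections (same condition with $u_j,v_i$), then add $u_j$ to $S_1$, $v_i$ to $S_2$, set $\pi(u_j):=v_i$ and stop iteration $i$; otherwise increase $j$. Finally output $H_1=G_1[S_1]$, $H_2=G_2[S_2]$ and $\pi$. *)

theory Defs
  imports "HOL-Probability.Probability"
begin

record 'a sgraph =
  verts :: "'a set"
  edges :: "'a set set"

definition two_subsets :: "'a set \<Rightarrow> 'a set set" where
  "two_subsets V = {e. e \<subseteq> V \<and> card e = 2}"

definition simple_graph_on :: "'a set \<Rightarrow> 'a sgraph \<Rightarrow> bool" where
  "simple_graph_on V G \<longleftrightarrow> verts G = V \<and> edges G \<subseteq> two_subsets V"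

definition adj :: "'a sgraph \<Rightarrow> 'a \<Rightarrow> 'a \<Rightarrow> bool" where
  "adj G x y \<longleftrightarrow> {x, y} \<in> edges G"

definition induce :: "'a sgraph \<Rightarrow> 'a set \<Rightarrow> 'a sgraph" where
  "induce G S = \<lparr>verts = S, edges = {e \<in> edges G. e \<subseteq> S}\<rparr>"

definition induced_subgraph :: "'a sgraph \<Rightarrow> 'a sgraph \<Rightarrow> bool" where
  "induced_subgraph H G \<longleftrightarrow> verts H \<subseteq> verts G \<and> H = induce G (verts H)"

definition graph_iso :: "('a \<Rightarrow> 'b) \<Rightarrow> 'a sgraph \<Rightarrow> 'b sgraph \<Rightarrow> bool" where
  "graph_iso f G H \<longleftrightarrow> bij_betw f (verts G) (verts H) \<and>
     (\<forall>x\<in>verts G. \<forall>y\<in>verts G. adj G x y \<longleftrightarrow> adj H (f x) (f y))"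

definition isomorphic :: "'a sgraph \<Rightarrow> 'b sgraph \<Rightarrow> bool" where
  "isomorphic G H \<longleftrightarrow> (\<exists>f. graph_iso f G H)"

definition lcis_solution ::
  "'a sgraph \<Rightarrow> 'b sgraph \<Rightarrow> 'a sgraph \<Rightarrow> 'b sgraph \<Rightarrow> bool" where
  "lcis_solution G1 G2 H1 H2 \<longleftrightarrow>
     induced_subgraph H1 G1 \<and> induced_subgraph H2 G2 \<and> isomorphic H1 H2"

definition erdos_renyi :: "nat \<Rightarrow> real \<Rightarrow> nat sgraph pmf" where
  "erdos_renyi n p =
     map_pmf (\<lambda>X. \<lparr>verts = {1..n}, edges = {e \<in> two_subsets {1..n}. X e}\<rparr>)
       (Pi_pmf (two_subsets {1..n}) False (\<lambda>_. bernoulli_pmf p))"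

lemma set_pmf_erdos_renyi:
  assumes "0 < p" "p < 1"
  shows "set_pmf (erdos_renyi n p) = {G. simple_graph_on {1..n} G}"
proof -
  let ?P = "two_subsets {1..n}"
  have fin: "finite ?P"
    by (rule finite_subset[of _ "Pow {1..n}"]) (auto simp: two_subsets_def)
  have "set_pmf (Pi_pmf ?P False (\<lambda>_. bernoulli_pmf p)) = PiE_dflt ?P False (\<lambda>_. UNIV)"
    using assms unfolding set_Pi_pmf[OF fin] by (simp add: set_pmf_bernoulli comp_def)
  moreover have "(\<lambda>X. \<lparr>verts = {1..n}, edges = {e \<in> ?P. X e}\<rparr>) ` PiE_dflt ?P False (\<lambda>_. UNIV)
      = {G. simple_graph_on {1..n} G}" (is "?f ` _ = _")
  proof (intro equalityI subsetI)
    fix G :: "nat sgraph" assume "G \<in> {G. simple_graph_on {1..n} G}"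
    then have G: "verts G = {1..n}" "edges G \<subseteq> ?P" by (auto simp: simple_graph_on_def)
    then have "G = ?f (\<lambda>e. e \<in> edges G)" by (cases G) auto
    moreover have "(\<lambda>e. e \<in> edges G) \<in> PiE_dflt ?P False (\<lambda>_. UNIV)"
      using G by (auto simp: PiE_dflt_def)
    ultimately show "G \<in> ?f ` PiE_dflt ?P False (\<lambda>_. UNIV)" by (rule image_eqI)
  qed (auto simp: simple_graph_on_def)
  ultimately show ?thesis by (simp add: erdos_renyi_def)
qed

text \<open>An ordering of a set of \<open>n\<close> vertices; only its values at the indices
  \<open>1, \<dots>, n\<close> matter.\<close>

definition vertex_ordering :: "nat \<Rightarrow> 'a set \<Rightarrow> (nat \<Rightarrow> 'a) \<Rightarrow> bool" where
  "vertex_ordering n V u \<longleftrightarrow> bij_betw u {1..n} V"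

type_synonym ('a, 'b) greedy_state = "'a set \<times> 'b set \<times> ('a \<rightharpoonup> 'b)"

definition identical_connections ::
  "'a sgraph \<Rightarrow> 'b sgraph \<Rightarrow> ('a, 'b) greedy_state \<Rightarrow> 'a \<Rightarrow> 'b \<Rightarrow> bool" where
  "identical_connections G1 G2 = (\<lambda>(S1, S2, \<pi>) x y.
     \<forall>u'\<in>S1. adj G1 x u' \<longleftrightarrow> adj G2 y (the (\<pi> u')))"

definition add_pair :: "'a \<Rightarrow> 'b \<Rightarrow> ('a, 'b) greedy_state \<Rightarrow> ('a, 'b) greedy_state" where
  "add_pair x y = (\<lambda>(S1, S2, \<pi>). (insert x S1, insert y S2, \<pi>(x \<mapsto> y)))"

text \<open>The body of the inner loop for the indices \<open>i\<close> and \<open>j\<close>; the result is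
  \<open>None\<close> if no pair is added. Every vertex used before iteration \<open>i\<close> has an index below
  \<open>i\<close>, which is why membership is not tested for the vertex with index \<open>i\<close>.\<close>

definition greedy_try ::
  "'a sgraph \<Rightarrow> 'b sgraph \<Rightarrow> (nat \<Rightarrow> 'a) \<Rightarrow> (nat \<Rightarrow> 'b) \<Rightarrow> nat \<Rightarrow> nat \<Rightarrow>
     ('a, 'b) greedy_state \<Rightarrow> ('a, 'b) greedy_state option" where
  "greedy_try G1 G2 u v i j st = (case st of (S1, S2, \<pi>) \<Rightarrow>
     if v j \<notin> S2 \<and> identical_connections G1 G2 st (u i) (v j)
     then Some (add_pair (u i) (v j) st)
     else if u j \<notin> S1 \<and> identical_connections G1 G2 st (u j) (v i)
     then Some (add_pair (u j) (v i) st)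
     else None)"

fun greedy_scan ::
  "'a sgraph \<Rightarrow> 'b sgraph \<Rightarrow> (nat \<Rightarrow> 'a) \<Rightarrow> (nat \<Rightarrow> 'b) \<Rightarrow> nat \<Rightarrow> nat list \<Rightarrow>
     ('a, 'b) greedy_state \<Rightarrow> ('a, 'b) greedy_state" where
  "greedy_scan G1 G2 u v i [] st = st"
| "greedy_scan G1 G2 u v i (j # js) st =
     (case greedy_try G1 G2 u v i j st of
        Some st' \<Rightarrow> st'
      | None \<Rightarrow> greedy_scan G1 G2 u v i js st)"

definition greedy_loop ::
  "nat \<Rightarrow> 'a sgraph \<Rightarrow> 'b sgraph \<Rightarrow> (nat \<Rightarrow> 'a) \<Rightarrow> (nat \<Rightarrow> 'b) \<Rightarrow> ('a, 'b) greedy_state" where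
  "greedy_loop n G1 G2 u v =
     fold (\<lambda>i. greedy_scan G1 G2 u v i [1..<Suc i]) [1..<Suc n] ({}, {}, Map.empty)"

definition greedy ::
  "nat \<Rightarrow> 'a sgraph \<Rightarrow> 'b sgraph \<Rightarrow> (nat \<Rightarrow> 'a) \<Rightarrow> (nat \<Rightarrow> 'b) \<Rightarrow>
     'a sgraph \<times> 'b sgraph \<times> ('a \<rightharpoonup> 'b)" where
  "greedy n G1 G2 u v =
     (case greedy_loop n G1 G2 u v of (S1, S2, \<pi>) \<Rightarrow> (induce G1 S1, induce G2 S2, \<pi>))"

end

(* Cut the n iterations into M ~ 2 log_2 n windows. If fewer than (2 - eps) log_2 n < M pairs are
   added, then some window adds none, so the partial isomorphism pi of size k stays fixed there
   and no two vertices u_i, v_j with both indices in the window have identical connections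
   with respect to pi. For a fixed pi the relevant edges are independent fair coins. Split
   the window into B ~ 2 n^(eps/4) blocks of s indices: by the second moment method a single block
   contains no such pair with probability at most 2^k / s^2 <= 1/e, and the blocks are independent,
   giving exp(-B). This beats the union bound over all windows and all pi, of which there are only
   exp(O(log^2 n)), so the history of the algorithm never has to be conditioned on. *)
theory Submission
  imports Defs "HOL-Real_Asymp.Real_Asymp"
begin

subsection \<open>Fair coin flips\<close>

text \<open>By Fubini, a conditional probability that is the same for every outcome of the first
  component is the unconditional one. This is how one graph is frozen while the edges of the other
  stay random.\<close>

lemma prob_pair_pmf_const:
  assumes "\<And>x. measure_pmf.prob N {y. P x y} = c"
  shows "measure_pmf.prob (pair_pmf M N) {w. P (fst w) (snd w)} = c"
proof -
  have "emeasure (pair_pmf M N) {w. P (fst w) (snd w)}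
      = (\<integral>\<^sup>+x. emeasure N {y. P x y} \<partial>M)"
    by (subst nn_integral_indicator[symmetric], simp, subst nn_integral_pair_pmf')
      (auto intro!: nn_integral_cong simp: nn_integral_indicator[symmetric] indicator_def
         simp del: nn_integral_indicator)
  also have "\<dots> = (\<integral>\<^sup>+x. ennreal c \<partial>M)"
    by (simp add: measure_pmf.emeasure_eq_measure assms)
  also have "\<dots> = ennreal c" by simp
  finally show ?thesis
    using assms by (metis measure_pmf.emeasure_eq_measure ennreal_inj measure_nonneg)
qed

lemma prob_pair_pmf_const':
  assumes "\<And>y. measure_pmf.prob M {x. P x y} = c"
  shows "measure_pmf.prob (pair_pmf M N) {w. P (fst w) (snd w)} = c"
  using prob_pair_pmf_const[of M "\<lambda>y x. P x y" c N] assms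
  by (subst pair_commute_pmf) (simp add: vimage_def case_prod_unfold)

lemma prob_pair_pmf_conj:
  "measure_pmf.prob (pair_pmf M N) {w. P (fst w) \<and> Q (snd w)}
     = measure_pmf.prob M {x. P x} * measure_pmf.prob N {y. Q y}"
proof -
  have "emeasure (pair_pmf M N) {w. P (fst w) \<and> Q (snd w)}
      = (\<integral>\<^sup>+x. \<integral>\<^sup>+y. indicator {x. P x} x * indicator {y. Q y} y \<partial>N \<partial>M)"
    by (subst nn_integral_indicator[symmetric], simp, subst nn_integral_pair_pmf')
      (auto intro!: nn_integral_cong simp: indicator_def)
  also have "\<dots> = emeasure M {x. P x} * emeasure N {y. Q y}"
    by (simp add: nn_integral_cmult nn_integral_multc)
  finally show ?thesis
    by (simp add: measure_def enn2real_mult)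
qed

text \<open>The map only permutes four independent components, so both sides give a point the same
  product of four masses.\<close>

lemma pair_pmf_interchange:
  "pair_pmf (pair_pmf a b) (pair_pmf c d)
     = map_pmf (\<lambda>((x, z), (y, w)). ((x, y), (z, w))) (pair_pmf (pair_pmf a c) (pair_pmf b d))"
proof (rule pmf_eqI)
  fix q :: "('a \<times> 'b) \<times> ('c \<times> 'd)"
  obtain x y z w where q: "q = ((x, y), (z, w))" by (metis prod.exhaust)
  let ?f = "\<lambda>((x, z), (y, w)). ((x, y), (z, w))"
  have "inj ?f" by (auto simp: inj_on_def)
  from pmf_map_inj'[OF this, of _ "((x, z), (y, w))"]
  show "pmf (pair_pmf (pair_pmf a b) (pair_pmf c d)) q
    = pmf (map_pmf ?f (pair_pmf (pair_pmf a c) (pair_pmf b d))) q"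
    by (simp add: q pmf_pair)
qed

definition coin_flips :: "'e set \<Rightarrow> ('e \<Rightarrow> bool) pmf" where
  "coin_flips E = Pi_pmf E False (\<lambda>_. bernoulli_pmf (1/2))"

text \<open>Injectivity makes the conditions concern distinct coins. The event is then a box, with a
  factor 1/2 for each prescribed coin and 1 for every other coin.\<close>

lemma prob_coin_flips_prescribed:
  assumes "finite E" "inj_on \<phi> T" "\<phi> ` T \<subseteq> E"
  shows "measure_pmf.prob (coin_flips E) {f. \<forall>t\<in>T. f (\<phi> t) = c t} = (1/2) ^ card T"
proof -
  define B where "B e = (if e \<in> \<phi> ` T then {c (the_inv_into T \<phi> e)} else UNIV)" for e
  have "{f. \<forall>t\<in>T. f (\<phi> t) = c t} = Pi E B"
    using assms(2,3) by (auto simp: B_def Pi_def the_inv_into_f_f)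
  moreover have "measure_pmf.prob (bernoulli_pmf (1/2)) (B e) = (if e \<in> \<phi> ` T then 1/2 else 1)" for e
    by (auto simp: B_def measure_pmf_single pmf_bernoulli_half)
  ultimately have "measure_pmf.prob (coin_flips E) {f. \<forall>t\<in>T. f (\<phi> t) = c t}
      = (\<Prod>e\<in>E. if e \<in> \<phi> ` T then 1/2 else 1)"
    using assms(1) by (simp add: coin_flips_def measure_Pi_pmf_Pi)
  also have "\<dots> = (\<Prod>e\<in>\<phi> ` T. 1/2)"
    using assms(1,3) by (simp add: prod.If_cases Int_absorb1)
  also have "\<dots> = (1/2) ^ card T"
    using assms(2) by (simp add: card_image)
  finally show ?thesis .
qed

lemma coin_flips_split:
  assumes "finite E"
  shows "coin_flips E = map_pmf (\<lambda>(f, g) x. if x \<in> A then f x else g x)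
           (pair_pmf (coin_flips (E \<inter> A)) (coin_flips (E - A)))"
proof -
  have "coin_flips E = coin_flips ((E \<inter> A) \<union> (E - A))"
    by (simp add: Int_Diff_Un)
  also have "\<dots> = map_pmf (\<lambda>(f, g) x. if x \<in> E \<inter> A then f x else g x)
           (pair_pmf (coin_flips (E \<inter> A)) (coin_flips (E - A)))"
    unfolding coin_flips_def using assms by (intro Pi_pmf_union) auto
  \<comment> \<open>A point of \<open>A\<close> outside \<open>E\<close> gets the default
    \<open>False\<close> from both functions, so on the support the test for
    \<open>E \<inter> A\<close> may become a test for \<open>A\<close>.\<close>
  also have "\<dots> = map_pmf (\<lambda>(f, g) x. if x \<in> A then f x else g x)
           (pair_pmf (coin_flips (E \<inter> A)) (coin_flips (E - A)))"
    using set_Pi_pmf_subset[of "E \<inter> A"] set_Pi_pmf_subset[of "E - A"] assms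
    unfolding coin_flips_def
    by (intro map_pmf_cong refl) (fastforce simp: fun_eq_iff)
  finally show ?thesis .
qed

text \<open>Cut the first function along \<open>A\<close> and the second along \<open>B\<close>.
  Then \<open>P\<close> reads only the two inner pieces and, by disjointness, \<open>Q\<close> only
  the two outer ones; the inner pair is independent of the outer pair.\<close>

lemma coin_flips_indep:
  assumes fin: "finite E"
    and P: "\<And>f f' g g'. \<forall>e\<in>A. f e = f' e \<Longrightarrow> \<forall>e\<in>B. g e = g' e \<Longrightarrow> P f g \<longleftrightarrow> P f' g'"
    and Q: "\<And>f f' g g'. \<forall>e\<in>A'. f e = f' e \<Longrightarrow> \<forall>e\<in>B'. g e = g' e \<Longrightarrow> Q f g \<longleftrightarrow> Q f' g'"
    and disj: "A \<inter> A' = {}" "B \<inter> B' = {}"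
  shows "measure_pmf.prob (pair_pmf (coin_flips E) (coin_flips E)) {w. P (fst w) (snd w) \<and> Q (fst w) (snd w)}
       = measure_pmf.prob (pair_pmf (coin_flips E) (coin_flips E)) {w. P (fst w) (snd w)}
       * measure_pmf.prob (pair_pmf (coin_flips E) (coin_flips E)) {w. Q (fst w) (snd w)}"
proof -
  define h where "h A w x = (if x \<in> A then fst w x else snd w x)"
    for A :: "'a set" and w :: "('a \<Rightarrow> bool) \<times> ('a \<Rightarrow> bool)" and x
  define L where "L = pair_pmf (coin_flips (E \<inter> A)) (coin_flips (E \<inter> B))"
  define R where "R = pair_pmf (coin_flips (E - A)) (coin_flips (E - B))"
  have h: "(\<lambda>(f, g) x. if x \<in> A then f x else g x) = h A" for A
    by (auto simp: fun_eq_iff h_def)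
  have split: "coin_flips E = map_pmf (h A) (pair_pmf (coin_flips (E \<inter> A)) (coin_flips (E - A)))" for A
    using coin_flips_split[OF fin, of A] by (simp add: h)
  \<comment> \<open>\<open>k\<close> glues the two functions back together from the inner pieces
    \<open>fst q\<close> and the outer pieces \<open>snd q\<close>.\<close>
  define k where "k q = (h A (fst (fst q), fst (snd q)), h B (snd (fst q), snd (snd q)))"
    for q :: "(('a \<Rightarrow> bool) \<times> ('a \<Rightarrow> bool)) \<times> (('a \<Rightarrow> bool) \<times> ('a \<Rightarrow> bool))"
  have "pair_pmf (coin_flips E) (coin_flips E) = map_pmf (\<lambda>(x, y). (h A x, h B y))
      (pair_pmf (pair_pmf (coin_flips (E \<inter> A)) (coin_flips (E - A)))
         (pair_pmf (coin_flips (E \<inter> B)) (coin_flips (E - B))))"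
    unfolding map_pair using split[of A] split[of B] by simp
  also have "\<dots> = map_pmf k (pair_pmf L R)"
    by (subst pair_pmf_interchange)
      (simp add: L_def R_def k_def[abs_def] pmf.map_comp o_def case_prod_unfold)
  finally have k: "pair_pmf (coin_flips E) (coin_flips E) = map_pmf k (pair_pmf L R)" .
  have P': "P (fst (k q)) (snd (k q)) \<longleftrightarrow> P (fst (fst q)) (snd (fst q))" for q
    by (intro P) (auto simp: k_def h_def)
  have Q': "Q (fst (k q)) (snd (k q)) \<longleftrightarrow> Q (fst (snd q)) (snd (snd q))" for q
    using disj by (intro Q) (auto simp: k_def h_def)
  have "measure_pmf.prob (pair_pmf L R) {q. P (fst (fst q)) (snd (fst q))}
      = measure_pmf.prob L {q. P (fst q) (snd q)}"
    using prob_pair_pmf_conj[of L R "\<lambda>q. P (fst q) (snd q)" "\<lambda>_. True"] by simp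
  moreover have "measure_pmf.prob (pair_pmf L R) {q. Q (fst (snd q)) (snd (snd q))}
      = measure_pmf.prob R {q. Q (fst q) (snd q)}"
    using prob_pair_pmf_conj[of L R "\<lambda>_. True" "\<lambda>q. Q (fst q) (snd q)"] by simp
  ultimately show ?thesis
    unfolding k measure_map_pmf vimage_def mem_Collect_eq P' Q'
    using prob_pair_pmf_conj[of L R "\<lambda>q. P (fst q) (snd q)" "\<lambda>q. Q (fst q) (snd q)"] by simp
qed

text \<open>Chebyshev's inequality: if \<open>N\<close> counts the events that occur and
  \<open>c\<close> is its mean, then c^2 P(N = 0) <= E (N - c)^2. Pairwise independence bounds this
  variance by \<open>c\<close>, which leaves 1/c.\<close>

lemma prob_no_event_le:
  assumes fin: "finite I" "I \<noteq> {}" and q: "q > 0"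
    and single: "\<And>i. i \<in> I \<Longrightarrow> measure_pmf.prob M {x. Z i x} = q"
    and double: "\<And>i j. i \<in> I \<Longrightarrow> j \<in> I \<Longrightarrow> i \<noteq> j \<Longrightarrow>
      measure_pmf.prob M {x. Z i x \<and> Z j x} = q\<^sup>2"
  shows "measure_pmf.prob M {x. \<forall>i\<in>I. \<not> Z i x} \<le> 1 / (real (card I) * q)"
proof -
  define c where "c = real (card I) * q"
  have c: "c > 0" using fin q by (simp add: c_def card_gt_0_iff)
  define N where "N x = (\<Sum>i\<in>I. indicator {x. Z i x} x :: real)" for x
  have int: "integrable M (indicator A :: _ \<Rightarrow> real)" for A
    by (simp add: measure_pmf.emeasure_eq_measure)
  have N2: "(N x)\<^sup>2 = (\<Sum>i\<in>I. \<Sum>j\<in>I. indicator {x. Z i x \<and> Z j x} x)" for x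
    by (simp add: N_def power2_eq_square sum_product indicator_def)
      (intro sum.cong refl, auto)
  have intN: "integrable M N" unfolding N_def by (intro Bochner_Integration.integrable_sum int)
  have intN2: "integrable M (\<lambda>x. (N x)\<^sup>2)"
    unfolding N2 by (intro Bochner_Integration.integrable_sum int)
  have EN: "measure_pmf.expectation M N = c"
    unfolding N_def by (subst Bochner_Integration.integral_sum[OF int]) (simp add: single c_def)
  have "measure_pmf.expectation M (\<lambda>x. (N x)\<^sup>2)
      = (\<Sum>i\<in>I. \<Sum>j\<in>I. measure_pmf.prob M {x. Z i x \<and> Z j x})"
    unfolding N2
    by (subst Bochner_Integration.integral_sum, intro Bochner_Integration.integrable_sum int,
      intro sum.cong refl, subst Bochner_Integration.integral_sum[OF int]) simp
  \<comment> \<open>A diagonal term is \<open>q\<close>; bounding it by q^2 + q gives every pair the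
    summand q^2, so the double sum is c^2 plus the diagonal surplus \<open>c\<close>.\<close>
  also have "\<dots> \<le> (\<Sum>i\<in>I. \<Sum>j\<in>I. q\<^sup>2 + (if i = j then q else 0))"
    using q by (intro sum_mono) (auto simp: single double)
  also have "\<dots> = c\<^sup>2 + c"
    using fin by (simp add: sum.distrib c_def power2_eq_square algebra_simps)
  finally have EN2: "measure_pmf.expectation M (\<lambda>x. (N x)\<^sup>2) \<le> c\<^sup>2 + c" .
  have "c\<^sup>2 * measure_pmf.prob M {x. \<forall>i\<in>I. \<not> Z i x}
      = measure_pmf.expectation M (\<lambda>x. c\<^sup>2 * indicator {x. \<forall>i\<in>I. \<not> Z i x} x)"
    by simp
  also have "\<dots> \<le> measure_pmf.expectation M (\<lambda>x. (N x)\<^sup>2 - 2 * c * N x + c\<^sup>2)"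
  proof (rule integral_mono)
    fix x
    have "0 \<le> (N x - c)\<^sup>2" by simp
    then show "c\<^sup>2 * indicator {x. \<forall>i\<in>I. \<not> Z i x} x \<le> (N x)\<^sup>2 - 2 * c * N x + c\<^sup>2"
      by (auto simp: indicator_def N_def power2_diff algebra_simps)
  qed (use intN intN2 int in simp_all)
  also have "\<dots> = measure_pmf.expectation M (\<lambda>x. (N x)\<^sup>2) - 2 * c * c + c\<^sup>2"
    using intN intN2 EN by simp
  also have "\<dots> \<le> c"
    using EN2 by (simp add: power2_eq_square)
  finally have "c * (c * measure_pmf.prob M {x. \<forall>i\<in>I. \<not> Z i x}) \<le> c * 1"
    by (simp add: power2_eq_square mult.assoc)
  then have "c * measure_pmf.prob M {x. \<forall>i\<in>I. \<not> Z i x} \<le> 1"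
    using c mult_le_cancel_left_pos by blast
  then show ?thesis
    using c unfolding c_def[symmetric] by (simp add: field_simps)
qed

subsection \<open>Agreement with respect to a fixed partial matching\<close>

text \<open>\<open>R\<close> is the graph of the partial isomorphism, and \<open>f\<close>, \<open>g\<close> are the edge indicators of the two
  graphs; \<open>agree R a b f g\<close> says that \<open>a\<close> and \<open>b\<close> have identical connections.\<close>

definition agree :: "('a \<times> 'b) set \<Rightarrow> 'a \<Rightarrow> 'b \<Rightarrow> ('a set \<Rightarrow> bool) \<Rightarrow> ('b set \<Rightarrow> bool) \<Rightarrow> bool" where
  "agree R a b f g \<longleftrightarrow> (\<forall>r\<in>R. f {a, fst r} = g {b, snd r})"

lemma disjoint_spokes:
  assumes "X \<inter> Y = {}" "X \<inter> h ` R = {}"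
  shows "{{a, h r} | a r. a \<in> X \<and> r \<in> R} \<inter> {{a, h r} | a r. a \<in> Y \<and> r \<in> R} = {}"
proof (rule equals0I)
  fix e assume "e \<in> {{a, h r} | a r. a \<in> X \<and> r \<in> R} \<inter> {{a, h r} | a r. a \<in> Y \<and> r \<in> R}"
  then obtain a r a' r' where *: "a \<in> X" "r \<in> R" "a' \<in> Y" "r' \<in> R" "{a, h r} = {a', h r'}"
    by auto
  then have "a = a' \<or> a = h r'" by (auto simp: doubleton_eq_iff)
  then show False using * assms by blast
qed

text \<open>\<open>R\<close> is chosen before the graphs are drawn, so no condition relates it to
  their edges. The union bound will range over all such relations.\<close>

locale partial_matching =
  fixes V :: "'a set" and R :: "('a \<times> 'a) set"
  assumes finite_V: "finite V"
    and R_subset: "R \<subseteq> V \<times> V"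
    and inj_fst: "inj_on fst R"
    and inj_snd: "inj_on snd R"
begin

abbreviation flips2 :: "(('a set \<Rightarrow> bool) \<times> ('a set \<Rightarrow> bool)) pmf" where
  "flips2 \<equiv> pair_pmf (coin_flips (two_subsets V)) (coin_flips (two_subsets V))"

section \<open>Edges between free and matched vertices of a fixed matching\<close>

lemma finite_edges: "finite (two_subsets V)"
  using finite_V by (auto simp: two_subsets_def intro: finite_subset[of _ "Pow V"])

text \<open>The edges involved are pairwise distinct: vertices of \<open>J\<close> are unmatched, so
  no edge arises with its endpoints swapped, and \<open>inj_snd\<close> separates the matched
  endpoints.\<close>

lemma prob_flips_snd:
  assumes J: "J \<subseteq> V - snd ` R"
  shows "measure_pmf.prob (coin_flips (two_subsets V)) {g. \<forall>(b, r)\<in>J \<times> R. g {b, snd r} = c b r}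
    = (1/2) ^ (card J * card R)"
proof -
  have "inj_on (\<lambda>(b, r). {b, snd r}) (J \<times> R)"
    using J inj_snd by (auto simp: inj_on_def doubleton_eq_iff)
  moreover have "(\<lambda>(b, r). {b, snd r}) ` (J \<times> R) \<subseteq> two_subsets V"
    using J R_subset by (force simp: two_subsets_def card_insert_if)
  ultimately show ?thesis
    using prob_coin_flips_prescribed[OF finite_edges, of "\<lambda>(b, r). {b, snd r}" "J \<times> R" "\<lambda>(b, r). c b r"]
    by (simp add: card_cartesian_product case_prod_unfold)
qed

lemma prob_flips_fst:
  assumes I: "I \<subseteq> V - fst ` R"
  shows "measure_pmf.prob (coin_flips (two_subsets V)) {f. \<forall>(a, r)\<in>I \<times> R. f {a, fst r} = c a r}
    = (1/2) ^ (card I * card R)"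
proof -
  have "inj_on (\<lambda>(b, r). {b, fst r}) (I \<times> R)"
    using I inj_fst by (auto simp: inj_on_def doubleton_eq_iff)
  moreover have "(\<lambda>(b, r). {b, fst r}) ` (I \<times> R) \<subseteq> two_subsets V"
    using I R_subset by (force simp: two_subsets_def card_insert_if)
  ultimately show ?thesis
    using prob_coin_flips_prescribed[OF finite_edges, of "\<lambda>(b, r). {b, fst r}" "I \<times> R" "\<lambda>(b, r). c b r"]
    by (simp add: card_cartesian_product case_prod_unfold)
qed

lemma prob_agree:
  assumes b: "b \<in> V - snd ` R"
  shows "measure_pmf.prob flips2 {w. agree R a b (fst w) (snd w)} = (1/2) ^ card R"
proof (rule prob_pair_pmf_const)
  fix f
  show "measure_pmf.prob (coin_flips (two_subsets V)) {g. agree R a b f g} = (1/2) ^ card R"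
    using prob_flips_snd[of "{b}" "\<lambda>_ r. f {a, fst r}"] b
    by (simp add: agree_def eq_commute[of "f _"])
qed

lemma prob_agree_two:
  assumes a: "a \<in> V - fst ` R" "a' \<in> V - fst ` R"
    and b: "b \<in> V - snd ` R" "b' \<in> V - snd ` R"
    and ne: "(a, b) \<noteq> (a', b')"
  shows "measure_pmf.prob flips2
    {w. agree R a b (fst w) (snd w) \<and> agree R a' b' (fst w) (snd w)} = ((1/2) ^ card R)\<^sup>2"
proof (cases "b = b'")
  case False
  show ?thesis
  proof (rule prob_pair_pmf_const)
    fix f
    \<comment> \<open>With \<open>f\<close> fixed, the values at twice \<open>card R\<close>
      distinct edges of the second graph are prescribed, also when \<open>a = a'\<close>.\<close>
    have "{g. agree R a b f g \<and> agree R a' b' f g}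
      = {g. \<forall>(c, r)\<in>{b, b'} \<times> R. g {c, snd r} = f {if c = b then a else a', fst r}}"
      using False by (auto simp: agree_def)
    then show "measure_pmf.prob (coin_flips (two_subsets V)) {g. agree R a b f g \<and> agree R a' b' f g}
      = ((1/2) ^ card R)\<^sup>2"
      using prob_flips_snd[of "{b, b'}" "\<lambda>c r. f {if c = b then a else a', fst r}"] b False
      by (simp add: power2_eq_square power_add)
  qed
next
  case True
  with ne have False: "a \<noteq> a'" by auto
  show ?thesis
  proof (rule prob_pair_pmf_const')
    fix g
    \<comment> \<open>Now the pairs differ in their first components, so the two graphs exchange
      roles.\<close>
    have "{f. agree R a b f g \<and> agree R a' b' f g}
      = {f. \<forall>(c, r)\<in>{a, a'} \<times> R. f {c, fst r} = g {if c = a then b else b', snd r}}"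
      using False by (auto simp: agree_def)
    then show "measure_pmf.prob (coin_flips (two_subsets V)) {f. agree R a b f g \<and> agree R a' b' f g}
      = ((1/2) ^ card R)\<^sup>2"
      using prob_flips_fst[of "{a, a'}" "\<lambda>c r. g {if c = a then b else b', snd r}"] a False
      by (simp add: power2_eq_square power_add)
  qed
qed

text \<open>The events that \<open>a\<close> and \<open>b\<close> agree are pairwise independent even when the pairs share a
  vertex: conditioning on the graph in which the vertices coincide leaves the edges at two
  distinct vertices of the other graph uniform. Chebyshev's inequality therefore suffices.\<close>

lemma prob_block_no_agree:
  assumes I: "I \<subseteq> V - fst ` R" "card I = s" and J: "J \<subseteq> V - snd ` R" "card J = s" and s: "s > 0"
  shows "measure_pmf.prob flips2 {w. \<forall>a\<in>I. \<forall>b\<in>J. \<not> agree R a b (fst w) (snd w)}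
    \<le> 2 ^ card R / (real s)\<^sup>2"
proof -
  have "finite I" "finite J" "I \<noteq> {}" "J \<noteq> {}"
    using I J s by (auto intro: card_ge_0_finite)
  note fin = this
  \<comment> \<open>The number of agreeing pairs in \<open>I \<times> J\<close> has mean s^2 /
    2^(card R); its inverse is the claimed bound.\<close>
  have "measure_pmf.prob flips2 {w. \<forall>p\<in>I \<times> J. \<not> agree R (fst p) (snd p) (fst w) (snd w)}
     \<le> 1 / (real (card (I \<times> J)) * (1/2) ^ card R)"
  proof (rule prob_no_event_le)
    fix p assume "p \<in> I \<times> J"
    then have "snd p \<in> J" by auto
    with J(1) have "snd p \<in> V - snd ` R" by (rule subsetD)
    then show "measure_pmf.prob flips2 {w. agree R (fst p) (snd p) (fst w) (snd w)} = (1/2) ^ card R"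
      by (rule prob_agree)
  next
    fix p p' assume p: "p \<in> I \<times> J" "p' \<in> I \<times> J" "p \<noteq> p'"
    have "fst p \<in> V - fst ` R" "fst p' \<in> V - fst ` R" "snd p \<in> V - snd ` R" "snd p' \<in> V - snd ` R"
      using p subsetD[OF I(1), of "fst p"] subsetD[OF I(1), of "fst p'"]
        subsetD[OF J(1), of "snd p"] subsetD[OF J(1), of "snd p'"] by (simp_all add: mem_Times_iff)
    then show "measure_pmf.prob flips2 {w. agree R (fst p) (snd p) (fst w) (snd w) \<and>
        agree R (fst p') (snd p') (fst w) (snd w)} = ((1/2) ^ card R)\<^sup>2"
      by (rule prob_agree_two) (use p in \<open>simp add: prod_eq_iff\<close>)
  qed (use fin in auto)
  then show ?thesis
    using I J by (simp add: card_cartesian_product power2_eq_square power_divide)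
qed

text \<open>Only pairs inside a common block are considered. Distinct blocks then read disjoint sets
  of edges in either graph, so they are independent and their bounds multiply.\<close>

lemma prob_blocks_no_agree:
  assumes I: "\<And>k. k < m \<Longrightarrow> I k \<subseteq> V - fst ` R \<and> card (I k) = s"
    and J: "\<And>k. k < m \<Longrightarrow> J k \<subseteq> V - snd ` R \<and> card (J k) = s"
    and disj: "disjoint_family_on I {..<m}" "disjoint_family_on J {..<m}"
    and s: "s > 0"
  shows "measure_pmf.prob flips2
    {w. \<forall>k<m. \<forall>a\<in>I k. \<forall>b\<in>J k. \<not> agree R a b (fst w) (snd w)} \<le> (2 ^ card R / (real s)\<^sup>2) ^ m"
  using I J disj
proof (induction m)
  case 0
  then show ?case by simp
next
  case (Suc m)
  define P where "P f g \<longleftrightarrow> (\<forall>k<m. \<forall>a\<in>I k. \<forall>b\<in>J k. \<not> agree R a b f g)" for f g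
  define Q where "Q f g \<longleftrightarrow> (\<forall>a\<in>I m. \<forall>b\<in>J m. \<not> agree R a b f g)" for f g
  \<comment> \<open>\<open>A K\<close> and \<open>B K\<close> collect the edges of the first and
    second graph that the blocks with index in \<open>K\<close> inspect.\<close>
  define A where "A K = {{a, fst r} | a r. a \<in> (\<Union>k\<in>K. I k) \<and> r \<in> R}" for K
  define B where "B K = {{b, snd r} | b r. b \<in> (\<Union>k\<in>K. J k) \<and> r \<in> R}" for K
  have "I k \<inter> I m = {}" "J k \<inter> J m = {}" if "k < m" for k
    using Suc.prems(3,4) that by (auto simp: disjoint_family_on_def)
  then have sep: "(\<Union>k\<in>{..<m}. I k) \<inter> (\<Union>k\<in>{m}. I k) = {}" "(\<Union>k\<in>{..<m}. J k) \<inter> (\<Union>k\<in>{m}. J k) = {}"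
    by auto
  have "I k \<inter> fst ` R = {}" "J k \<inter> snd ` R = {}" if "k < m" for k
    using Suc.prems(1)[of k] Suc.prems(2)[of k] that by auto
  then have avoid: "(\<Union>k\<in>{..<m}. I k) \<inter> fst ` R = {}" "(\<Union>k\<in>{..<m}. J k) \<inter> snd ` R = {}"
    by blast+
  have AB: "A {..<m} \<inter> A {m} = {}" "B {..<m} \<inter> B {m} = {}"
    unfolding A_def B_def by (rule disjoint_spokes[OF sep(1) avoid(1)] disjoint_spokes[OF sep(2) avoid(2)])+
  have *: "agree R a b f g \<longleftrightarrow> agree R a b f' g'"
    if "\<forall>e\<in>A K. f e = f' e" "\<forall>e\<in>B K. g e = g' e" "k \<in> K" "a \<in> I k" "b \<in> J k" for a b f f' g g' k K
  proof -
    have "f {a, fst r} = f' {a, fst r}" "g {b, snd r} = g' {b, snd r}" if "r \<in> R" for r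
      using \<open>\<forall>e\<in>A K. f e = f' e\<close> \<open>\<forall>e\<in>B K. g e = g' e\<close> \<open>k \<in> K\<close> \<open>a \<in> I k\<close> \<open>b \<in> J k\<close> that
      unfolding A_def B_def by blast+
    then show ?thesis by (simp add: agree_def)
  qed
  have PP: "P f g \<longleftrightarrow> P f' g'" if "\<forall>e\<in>A {..<m}. f e = f' e" "\<forall>e\<in>B {..<m}. g e = g' e" for f f' g g'
    using *[OF that] by (auto simp: P_def)
  have QQ: "Q f g \<longleftrightarrow> Q f' g'" if "\<forall>e\<in>A {m}. f e = f' e" "\<forall>e\<in>B {m}. g e = g' e" for f f' g g'
    using *[OF that] by (auto simp: Q_def)
  have "{w. \<forall>k<Suc m. \<forall>a\<in>I k. \<forall>b\<in>J k. \<not> agree R a b (fst w) (snd w)}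
      = {w. P (fst w) (snd w) \<and> Q (fst w) (snd w)}"
    by (auto simp: P_def Q_def less_Suc_eq)
  also have "measure_pmf.prob flips2 \<dots> = measure_pmf.prob flips2 {w. P (fst w) (snd w)}
      * measure_pmf.prob flips2 {w. Q (fst w) (snd w)}"
    by (rule coin_flips_indep[OF finite_edges PP QQ AB])
  also have "\<dots> \<le> (2 ^ card R / (real s)\<^sup>2) ^ m * (2 ^ card R / (real s)\<^sup>2)"
  proof (intro mult_mono)
    show "measure_pmf.prob flips2 {w. P (fst w) (snd w)} \<le> (2 ^ card R / (real s)\<^sup>2) ^ m"
      unfolding P_def using Suc.prems
      by (intro Suc.IH) (auto simp: disjoint_family_on_def)
    show "measure_pmf.prob flips2 {w. Q (fst w) (snd w)} \<le> 2 ^ card R / (real s)\<^sup>2"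
      unfolding Q_def using Suc.prems s by (intro prob_block_no_agree) auto
  qed auto
  finally show ?case by (simp add: mult.commute)
qed

end

subsection \<open>Runs of the algorithm\<close>

lemma adj_commute: "adj G x y \<longleftrightarrow> adj G y x"
  by (simp add: adj_def insert_commute)

lemma simple_graph_on_irrefl: "simple_graph_on V G \<Longrightarrow> \<not> adj G x x"
  by (auto simp: simple_graph_on_def adj_def two_subsets_def)

locale greedy_run =
  fixes n :: nat and V1 :: "'a set" and V2 :: "'b set"
    and G1 :: "'a sgraph" and G2 :: "'b sgraph"
    and u :: "nat \<Rightarrow> 'a" and v :: "nat \<Rightarrow> 'b"
  assumes simple1: "simple_graph_on V1 G1" and simple2: "simple_graph_on V2 G2"
    and ord1: "vertex_ordering n V1 u" and ord2: "vertex_ordering n V2 v"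
begin

section \<open>The state after a number of iterations and its invariant\<close>

definition state :: "nat \<Rightarrow> ('a, 'b) greedy_state" where
  "state i = fold (\<lambda>i. greedy_scan G1 G2 u v i [1..<Suc i]) [1..<Suc i] ({}, {}, Map.empty)"

text \<open>The index \<open>i\<close> records that vertices numbered above \<open>i\<close> are
  still free. This replaces the membership tests that \<open>greedy_try\<close> omits.\<close>

definition partial_iso :: "nat \<Rightarrow> ('a, 'b) greedy_state \<Rightarrow> bool" where
  "partial_iso i = (\<lambda>(S1, S2, \<pi>).
     S1 \<subseteq> u ` {1..i} \<and> S2 \<subseteq> v ` {1..i} \<and> dom \<pi> = S1 \<and> bij_betw (\<lambda>x. the (\<pi> x)) S1 S2 \<and>
     (\<forall>x\<in>S1. \<forall>y\<in>S1. adj G1 x y \<longleftrightarrow> adj G2 (the (\<pi> x)) (the (\<pi> y))))"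

lemma state_0: "state 0 = ({}, {}, Map.empty)"
  by (simp add: state_def)

lemma state_Suc: "state (Suc i) = greedy_scan G1 G2 u v (Suc i) [1..<Suc (Suc i)] (state i)"
  by (simp add: state_def)

text \<open>A failed attempt leaves the state alone, so every attempt of one scan is made against
  the same \<open>st\<close>.\<close>

lemma greedy_scan_cases:
  "greedy_scan G1 G2 u v i js st = st \<and> (\<forall>j\<in>set js. greedy_try G1 G2 u v i j st = None) \<or>
   (\<exists>j\<in>set js. greedy_try G1 G2 u v i j st = Some (greedy_scan G1 G2 u v i js st))"
  by (induction js) (auto split: option.splits)

lemma greedy_try_Some:
  assumes "greedy_try G1 G2 u v i j (S1, S2, \<pi>) = Some st'"
  obtains x y where "st' = add_pair x y (S1, S2, \<pi>)" "identical_connections G1 G2 (S1, S2, \<pi>) x y"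
    "(x, y) = (u i, v j) \<and> v j \<notin> S2 \<or> (x, y) = (u j, v i) \<and> u j \<notin> S1"
  using assms by (auto simp: greedy_try_def split: if_splits)

lemma fresh:
  assumes "partial_iso i (S1, S2, \<pi>)" "i < k" "k \<le> n"
  shows "u k \<notin> S1" "v k \<notin> S2"
proof -
  have inj: "inj_on u {1..n}" "inj_on v {1..n}"
    using ord1 ord2 by (auto simp: vertex_ordering_def bij_betw_def)
  have "u l \<noteq> u k" "v l \<noteq> v k" if "l \<in> {1..i}" for l
    using inj_onD[OF inj(1), of l k] inj_onD[OF inj(2), of l k] that assms(2,3) by auto
  then have "u k \<notin> u ` {1..i}" "v k \<notin> v ` {1..i}"
    by (metis imageE)+
  then show "u k \<notin> S1" "v k \<notin> S2"
    using assms(1) by (auto simp: partial_iso_def)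
qed

text \<open>Adjacency between the new and an old vertex is preserved because the connections are
  identical, and the new vertex against itself is settled by the absence of loops.\<close>

lemma partial_iso_add_pair:
  assumes st: "partial_iso i (S1, S2, \<pi>)"
    and x: "x \<in> u ` {1..Suc i}" "x \<notin> S1" and y: "y \<in> v ` {1..Suc i}" "y \<notin> S2"
    and ident: "identical_connections G1 G2 (S1, S2, \<pi>) x y"
  shows "partial_iso (Suc i) (add_pair x y (S1, S2, \<pi>))"
proof -
  have irrefl: "\<not> adj G1 x x" "\<not> adj G2 y y"
    using simple1 simple2 by (auto dest: simple_graph_on_irrefl)
  have "bij_betw (\<lambda>z. the ((\<pi>(x \<mapsto> y)) z)) (insert x S1) (insert y S2)"
  proof -
    have "bij_betw (\<lambda>z. the ((\<pi>(x \<mapsto> y)) z)) S1 S2"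
      using st x by (subst bij_betw_cong[of _ _ "\<lambda>z. the (\<pi> z)"]) (auto simp: partial_iso_def)
    then have "bij_betw (\<lambda>z. the ((\<pi>(x \<mapsto> y)) z)) (S1 \<union> {x}) (S2 \<union> {y})"
      using x y by (intro bij_betw_combine) auto
    then show ?thesis by simp
  qed
  moreover have "S1 \<subseteq> u ` {1..Suc i}" "S2 \<subseteq> v ` {1..Suc i}"
    using st by (auto simp: partial_iso_def)
  moreover have "adj G1 z w \<longleftrightarrow> adj G2 (the ((\<pi>(x \<mapsto> y)) z)) (the ((\<pi>(x \<mapsto> y)) w))"
    if zw: "z \<in> insert x S1" "w \<in> insert x S1" for z w
  proof -
    have ext: "adj G1 x z' \<longleftrightarrow> adj G2 y (the (\<pi> z'))" if "z' \<in> S1" for z'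
      using ident that by (simp add: identical_connections_def)
    consider "z = x" "w = x" | "z = x" "w \<in> S1" "w \<noteq> x" | "z \<in> S1" "z \<noteq> x" "w = x"
      | "z \<in> S1" "z \<noteq> x" "w \<in> S1" "w \<noteq> x"
      using zw x by auto
    then show ?thesis
    proof cases
      case 1
      then show ?thesis using irrefl by simp
    next
      case 2
      then show ?thesis using ext by simp
    next
      case 3
      then show ?thesis using ext[of z] by (simp add: adj_commute[of G1 z] adj_commute[of G2 "the (\<pi> z)"])
    next
      case 4
      then show ?thesis using st by (simp add: partial_iso_def)
    qed
  qed
  ultimately show ?thesis
    using st x y by (simp add: partial_iso_def add_pair_def)
qed

text \<open>The idle case keeps the failure of every attempted pair, since the absence of agreeing
  pairs in \<open>idle_window\<close> is read off from it.\<close>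

lemma step_cases:
  assumes st: "partial_iso i (state i)" and i: "Suc i \<le> n"
  obtains (same) "state (Suc i) = state i"
      "\<forall>j\<in>{1..Suc i}. greedy_try G1 G2 u v (Suc i) j (state i) = None"
  | (add) x y where "state (Suc i) = add_pair x y (state i)" "x \<notin> fst (state i)"
      "partial_iso (Suc i) (state (Suc i))"
proof -
  obtain S1 S2 \<pi> where S: "state i = (S1, S2, \<pi>)" by (metis prod.exhaust)
  consider "state (Suc i) = state i" "\<forall>j\<in>{1..Suc i}. greedy_try G1 G2 u v (Suc i) j (state i) = None"
    | j where "j \<in> {1..Suc i}" "greedy_try G1 G2 u v (Suc i) j (state i) = Some (state (Suc i))"
    using greedy_scan_cases[of "Suc i" "[1..<Suc (Suc i)]" "state i"]
    unfolding state_Suc[symmetric] by (auto simp: atLeastLessThanSuc_atLeastAtMost simp del: upt_Suc)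
  then show ?thesis
  proof cases
    case 1
    then show ?thesis by (rule same)
  next
    case (2 j)
    from 2(2) obtain x y where xy: "state (Suc i) = add_pair x y (S1, S2, \<pi>)"
      "identical_connections G1 G2 (S1, S2, \<pi>) x y"
      "(x, y) = (u (Suc i), v j) \<and> v j \<notin> S2 \<or> (x, y) = (u j, v (Suc i)) \<and> u j \<notin> S1"
      unfolding S by (rule greedy_try_Some)
    have "u (Suc i) \<notin> S1" "v (Suc i) \<notin> S2"
      using fresh[of i S1 S2 \<pi> "Suc i"] st i by (auto simp: S)
    with xy(3) 2(1) have *: "x \<in> u ` {1..Suc i}" "x \<notin> S1" "y \<in> v ` {1..Suc i}" "y \<notin> S2"
      by auto
    show ?thesis
      using partial_iso_add_pair[OF st[unfolded S] * xy(2)] xy(1) *(2) by (intro add) (auto simp: S)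
  qed
qed

lemma partial_iso_state: "i \<le> n \<Longrightarrow> partial_iso i (state i)"
proof (induction i)
  case 0
  then show ?case by (simp add: state_0 partial_iso_def bij_betw_def)
next
  case (Suc i)
  then have st: "partial_iso i (state i)" by simp
  from st Suc.prems show ?case
  proof (cases rule: step_cases)
    case same
    then show ?thesis using st by (force simp: partial_iso_def case_prod_unfold)
  next
    case (add x y)
    then show ?thesis by simp
  qed
qed

section \<open>Counting matched pairs\<close>

definition matched :: "nat \<Rightarrow> nat" where
  "matched i = card (fst (state i))"

lemma finite_matched: "i \<le> n \<Longrightarrow> finite (fst (state i))"
  using partial_iso_state[of i] by (auto simp: partial_iso_def case_prod_unfold intro: finite_subset)

lemma matched_Suc:
  assumes "Suc i \<le> n"
  obtains (same) "matched (Suc i) = matched i" "state (Suc i) = state i"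
      "\<forall>j\<in>{1..Suc i}. greedy_try G1 G2 u v (Suc i) j (state i) = None"
  | (add) "matched (Suc i) = Suc (matched i)"
proof -
  have "partial_iso i (state i)" using assms by (simp add: partial_iso_state)
  from this assms show ?thesis
  proof (cases rule: step_cases)
    case same
    then have "matched (Suc i) = matched i" by (simp add: matched_def)
    from this same show ?thesis by (rule that(1))
  next
    case (add x y)
    then have "matched (Suc i) = Suc (matched i)"
      using finite_matched[of i] assms by (simp add: matched_def add_pair_def case_prod_unfold)
    then show ?thesis by (rule that(2))
  qed
qed

lemma matched_mono: "i \<le> j \<Longrightarrow> j \<le> n \<Longrightarrow> matched i \<le> matched j"
proof (induction j)
  case (Suc j)
  show ?case
  proof (cases "i = Suc j")
    case False
    with Suc have "matched i \<le> matched j" by simp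
    also from Suc.prems(2) have "\<dots> \<le> matched (Suc j)"
      by (cases rule: matched_Suc) auto
    finally show ?thesis .
  qed simp
qed simp

text \<open>Each addition raises the count by one and nothing lowers it, so equal counts leave no
  room for an addition in between.\<close>

lemma state_const:
  assumes "i \<le> j" "j \<le> n" "matched i = matched j"
  shows "state j = state i"
  using assms
proof (induction j)
  case (Suc j)
  show ?case
  proof (cases "i = Suc j")
    case False
    with Suc.prems have "i \<le> j" "j \<le> n" by auto
    then have "matched i \<le> matched j" by (rule matched_mono)
    with Suc.prems(2) show ?thesis
      by (cases rule: matched_Suc) (use Suc \<open>i \<le> j\<close> \<open>j \<le> n\<close> in auto)
  qed auto
qed auto

lemma greedy_size: "greedy n G1 G2 u v = (H1, H2, \<pi>) \<Longrightarrow> card (verts H1) = matched n"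
  by (auto simp: greedy_def greedy_loop_def matched_def state_def induce_def split: prod.splits
      simp del: upt_Suc)

lemma greedy_correct:
  assumes "greedy n G1 G2 u v = (H1, H2, \<pi>)"
  shows "lcis_solution G1 G2 H1 H2" "dom \<pi> = verts H1" "graph_iso (\<lambda>x. the (\<pi> x)) H1 H2"
    "card (verts H1) = card (verts H2)"
proof -
  obtain S1 S2 where S: "state n = (S1, S2, \<pi>)" "H1 = induce G1 S1" "H2 = induce G2 S2"
    using assms by (auto simp: greedy_def greedy_loop_def state_def split: prod.splits simp del: upt_Suc)
  have st: "partial_iso n (S1, S2, \<pi>)"
    using partial_iso_state[of n] S by simp
  then have S1: "S1 \<subseteq> V1" and S2: "S2 \<subseteq> V2"
    using ord1 ord2 by (auto simp: partial_iso_def vertex_ordering_def bij_betw_def)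
  have bij: "bij_betw (\<lambda>x. the (\<pi> x)) S1 S2"
    using st by (simp add: partial_iso_def)
  then have im: "the (\<pi> x) \<in> S2" if "x \<in> S1" for x
    using that by (auto simp: bij_betw_def)
  show iso: "graph_iso (\<lambda>x. the (\<pi> x)) H1 H2"
    using st im by (auto simp: S graph_iso_def partial_iso_def induce_def adj_def)
  then show "lcis_solution G1 G2 H1 H2"
    using S1 S2 simple1 simple2
    by (auto simp: lcis_solution_def induced_subgraph_def isomorphic_def S induce_def simple_graph_on_def)
  show "dom \<pi> = verts H1"
    using st by (simp add: partial_iso_def S induce_def)
  show "card (verts H1) = card (verts H2)"
    using bij by (simp add: S induce_def bij_betw_same_card)
qed

text \<open>Two indices of a window in which nothing is added are compared when the larger one is
  processed, so that none of the pairs of the window can extend the current partial isomorphism.\<close>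

lemma idle_window:
  assumes M: "matched n < M" and MT: "M * T \<le> n"
  obtains w R where "w < M" "R \<subseteq> V1 \<times> V2" "card R \<le> matched n" "inj_on fst R" "inj_on snd R"
    "fst ` R \<inter> u ` {w * T<..w * T + T} = {}" "snd ` R \<inter> v ` {w * T<..w * T + T} = {}"
    "\<And>i j. i \<in> {w * T<..w * T + T} \<Longrightarrow> j \<in> {w * T<..w * T + T} \<Longrightarrow>
      \<not> (\<forall>r\<in>R. adj G1 (u i) (fst r) = adj G2 (v j) (snd r))"
proof -
  \<comment> \<open>Pigeonhole: if each of the \<open>M\<close> windows added a pair, the final
    count would be at least \<open>M\<close>.\<close>
  have "\<exists>w<M. matched (w * T + T) = matched (w * T)"
  proof (rule ccontr)
    assume *: "\<not> ?thesis"
    have "w \<le> M \<Longrightarrow> w \<le> matched (w * T)" for w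
    proof (induction w)
      case (Suc w)
      have n: "w * T + T \<le> n"
        using mult_le_mono1[OF Suc.prems, of T] MT by simp
      have "w < M" using Suc.prems by simp
      then have "matched (w * T) \<noteq> matched (w * T + T)"
        using * by metis
      moreover have "matched (w * T) \<le> matched (w * T + T)"
        by (rule matched_mono[OF le_add1 n])
      moreover have "w \<le> matched (w * T)"
        using Suc.IH \<open>w < M\<close> by simp
      ultimately have "Suc w \<le> matched (w * T + T)" by linarith
      then show ?case by (simp only: mult_Suc add.commute)
    qed (rule le0)
    from this[OF order_refl] have "M \<le> matched (M * T)" .
    also have "\<dots> \<le> matched n" by (rule matched_mono[OF MT order_refl])
    finally show False using M by simp
  qed
  then obtain w where w: "w < M" "matched (w * T + T) = matched (w * T)" by blast
  define p where "p = w * T"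
  have pn: "p + T \<le> n"
    using w(1) MT mult_le_mono1[of "Suc w" M T] by (simp add: p_def)
  obtain S1 S2 \<pi> where S: "state p = (S1, S2, \<pi>)" by (metis prod.exhaust)
  have st: "partial_iso p (S1, S2, \<pi>)"
    using partial_iso_state[of p] pn S by simp
  \<comment> \<open>The monotone count is squeezed between equal values at the two ends of the
    window.\<close>
  have const: "state k = (S1, S2, \<pi>)" "matched k = matched p" if "k \<in> {p..p + T}" for k
  proof -
    show m: "matched k = matched p"
      using that pn w matched_mono[of p k] matched_mono[of k "p + T"] by (auto simp: p_def)
    show "state k = (S1, S2, \<pi>)"
      using that pn m state_const[of p k] S by auto
  qed
  have none: "greedy_try G1 G2 u v i j (S1, S2, \<pi>) = None"
    if ij: "i \<in> {p<..p + T}" "j \<in> {1..i}" for i j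
  proof -
    obtain k where k: "i = Suc k" using ij(1) by (cases i) auto
    then have "Suc k \<le> n" using ij(1) pn by auto
    then show ?thesis
    proof (cases rule: matched_Suc)
      case same
      then show ?thesis using ij k const[of k] by auto
    next
      case add
      then show ?thesis using ij k const(2)[of k] const(2)[of i] by auto
    qed
  qed
  have "\<not> identical_connections G1 G2 (S1, S2, \<pi>) (u i) (v j)"
    if ij: "i \<in> {p<..p + T}" "j \<in> {p<..p + T}" for i j
  \<comment> \<open>For \<open>j \<le> i\<close> the pair is rejected by the first test of iteration
    \<open>i\<close>; otherwise by the second test of iteration \<open>j\<close>, with inner index
    \<open>i\<close>. Freshness rules out rejection by the membership test.\<close>
  proof (cases "j \<le> i")
    case True
    then show ?thesis
      using none[of i j] fresh[OF st, of j] ij pn by (auto simp: greedy_try_def split: if_splits)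
  next
    case False
    then show ?thesis
      using none[of j i] fresh[OF st, of i] ij pn by (auto simp: greedy_try_def split: if_splits)
  qed
  note no_match = this
  define R where "R = {(x, y). \<pi> x = Some y}"
  have dom: "dom \<pi> = S1" and bij: "bij_betw (\<lambda>x. the (\<pi> x)) S1 S2"
    using st by (auto simp: partial_iso_def)
  have R: "R = (\<lambda>x. (x, the (\<pi> x))) ` S1"
    using dom by (force simp: R_def image_iff)
  have fstR: "fst ` R = S1" and sndR: "snd ` R = S2"
    using bij by (auto simp: R image_image bij_betw_def)
  show ?thesis
  proof (rule that[of w R, folded p_def])
    show "w < M" by fact
    have "S1 \<subseteq> V1" "S2 \<subseteq> V2"
      using st ord1 ord2 pn by (auto 4 3 simp: partial_iso_def vertex_ordering_def bij_betw_def)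
    then show "R \<subseteq> V1 \<times> V2" using fstR sndR by force
    have "card R = matched p"
      by (simp add: R card_image inj_on_def matched_def S)
    then show "card R \<le> matched n" using matched_mono[of p n] pn by simp
    show "inj_on fst R" by (auto simp: R inj_on_def)
    show "inj_on snd R" using bij by (auto simp: R inj_on_def bij_betw_def)
    show "fst ` R \<inter> u ` {p<..p + T} = {}" "snd ` R \<inter> v ` {p<..p + T} = {}"
      unfolding fstR sndR using fresh[OF st] pn by auto
    show "\<not> (\<forall>r\<in>R. adj G1 (u i) (fst r) = adj G2 (v j) (snd r))"
      if "i \<in> {p<..p + T}" "j \<in> {p<..p + T}" for i j
      using no_match[OF that] by (auto simp: identical_connections_def R)
  qed
qed

end

subsection \<open>The union bound\<close>

definition graph_of :: "'a set \<Rightarrow> ('a set \<Rightarrow> bool) \<Rightarrow> 'a sgraph" where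
  "graph_of V f = \<lparr>verts = V, edges = {e \<in> two_subsets V. f e}\<rparr>"

lemma erdos_renyi_half: "erdos_renyi n (1/2) = map_pmf (graph_of {1..n}) (coin_flips (two_subsets {1..n}))"
  by (simp add: erdos_renyi_def graph_of_def[abs_def] coin_flips_def)

lemma simple_graph_of: "simple_graph_on V (graph_of V f)"
  by (auto simp: simple_graph_on_def graph_of_def)

lemma adj_graph_of: "x \<in> V \<Longrightarrow> y \<in> V \<Longrightarrow> x \<noteq> y \<Longrightarrow> adj (graph_of V f) x y \<longleftrightarrow> f {x, y}"
  by (auto simp: adj_def graph_of_def two_subsets_def)

text \<open>A crude count: there are \<open>M\<close> possible sizes, each with at most
  \<open>card A ^ M\<close> subsets. For pairs of vertices and logarithmic \<open>M\<close> this is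
  exp(O(log^2 n)).\<close>

lemma card_subsets_less:
  assumes "finite A" "A \<noteq> {}"
  shows "finite {R. R \<subseteq> A \<and> card R < M}" "card {R. R \<subseteq> A \<and> card R < M} \<le> M * card A ^ M"
proof -
  have eq: "{R. R \<subseteq> A \<and> card R < M} = (\<Union>k<M. {R. R \<subseteq> A \<and> card R = k})" by auto
  show "finite {R. R \<subseteq> A \<and> card R < M}" using assms by auto
  have pos: "card A > 0" using assms by (simp add: card_gt_0_iff)
  have "card {R. R \<subseteq> A \<and> card R < M} \<le> (\<Sum>k<M. card {R. R \<subseteq> A \<and> card R = k})"
    unfolding eq by (rule card_UN_le) simp
  also have "\<dots> \<le> (\<Sum>k<M. card A ^ M)"
  proof (rule sum_mono)
    fix k assume k: "k \<in> {..<M}"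
    have "card A choose k \<le> card A ^ k"
      by (cases "k \<le> card A") (auto simp: binomial_le_pow binomial_eq_0)
    also have "\<dots> \<le> card A ^ M" using k pos by (intro power_increasing) auto
    finally show "card {R. R \<subseteq> A \<and> card R = k} \<le> card A ^ M"
      using assms by (simp add: n_subsets)
  qed
  finally show "card {R. R \<subseteq> A \<and> card R < M} \<le> M * card A ^ M" by simp
qed

text \<open>The factors count the windows, count the candidate relations, and bound the failure of
  all \<open>B\<close> blocks of a window. The integer \<open>M\<close> serves the two counts, while
  the exponent of 2 keeps the possibly smaller real threshold \<open>\<rho>\<close>.\<close>

lemma prob_greedy_small:
  assumes u: "vertex_ordering n {1..n} u" and v: "vertex_ordering n {1..n} v"
    and M: "\<rho> \<le> real M" and n: "n > 0" "M * (B * s) \<le> n" and s: "s > 0"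
  shows "measure_pmf.prob (pair_pmf (erdos_renyi n (1/2)) (erdos_renyi n (1/2)))
      {(G1, G2). real (card (verts (fst (greedy n G1 G2 u v)))) < \<rho>}
    \<le> real M * (real M * (real n ^ 2) ^ M) * (2 powr \<rho> / (real s)\<^sup>2) ^ B"
proof -
  define V where "V = {1..n}"
  define \<mu> where "\<mu> = pair_pmf (coin_flips (two_subsets V)) (coin_flips (two_subsets V))"
  define T where "T = B * s"
  \<comment> \<open>The \<open>k\<close>-th block of \<open>s\<close> consecutive indices within
    window \<open>w\<close>.\<close>
  define slot where "slot w k = {w * T + k * s<..w * T + k * s + s}" for w k
  define \<R> where "\<R> = {R. R \<subseteq> V \<times> V \<and> card R < M}"
  define good where "good w R \<longleftrightarrow> inj_on fst R \<and> inj_on snd R \<and> real (card R) < \<rho> \<and>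
    fst ` R \<inter> u ` {w * T<..w * T + T} = {} \<and> snd ` R \<inter> v ` {w * T<..w * T + T} = {}"
    for w and R :: "(nat \<times> nat) set"
  \<comment> \<open>\<open>good\<close> does not depend on the graphs; placed inside the event, it
    makes the event empty for inadmissible pairs, which then need no separate treatment in the
    sum.\<close>
  define Ev where "Ev = (\<lambda>(w, R). {x. good w R \<and> (\<forall>k<B. \<forall>a\<in>u ` slot w k. \<forall>b\<in>v ` slot w k.
    \<not> agree R a b (fst x) (snd x))})"
  have inj: "inj_on u {1..n}" "inj_on v {1..n}" and img: "u ` {1..n} = V" "v ` {1..n} = V"
    using u v by (auto simp: vertex_ordering_def bij_betw_def V_def)
  have slot: "slot w k \<subseteq> {w * T<..w * T + T}" if "k < B" for w k
    using that mult_le_mono1[of "Suc k" B s] by (auto simp: slot_def T_def)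
  have window: "{w * T<..w * T + T} \<subseteq> {1..n}" if "w < M" for w
    using that mult_le_mono1[of "Suc w" M T] n(2) by (auto simp: T_def)
  have "finite V" "V \<noteq> {}" "card V = n" using n by (auto simp: V_def)
  then have \<R>: "finite \<R>" "card \<R> \<le> M * (n ^ 2) ^ M"
    using card_subsets_less[of "V \<times> V" M]
    by (auto simp: \<R>_def card_cartesian_product power2_eq_square)

  have Ev_le: "measure_pmf.prob \<mu> (Ev (w, R)) \<le> (2 powr \<rho> / (real s)\<^sup>2) ^ B"
    if wR: "w < M" "R \<in> \<R>" for w R
  proof (cases "good w R")
    case True
    interpret partial_matching V R
      using True wR by unfold_locales (auto simp: good_def \<R>_def V_def)
    have sub: "slot w k \<subseteq> {1..n}" if "k < B" for k
      using slot[OF that, of w] window[OF wR(1)] by blast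
    have disj: "slot w k \<inter> slot w l = {}" if "k \<noteq> l" for k l
      using that mult_le_mono1[of "Suc k" l s] mult_le_mono1[of "Suc l" k s]
      by (cases "k < l") (auto simp: slot_def)
    have "measure_pmf.prob flips2
      {x. \<forall>k<B. \<forall>a\<in>u ` slot w k. \<forall>b\<in>v ` slot w k. \<not> agree R a b (fst x) (snd x)}
      \<le> (2 ^ card R / (real s)\<^sup>2) ^ B"
    proof (rule prob_blocks_no_agree)
      fix k assume k: "k < B"
      have cards: "card (u ` slot w k) = s" "card (v ` slot w k) = s"
        using inj sub[OF k] by (auto simp: card_image inj_on_subset slot_def)
      have Diff: "Y \<subseteq> V - X" if "Y \<subseteq> V" "Y \<subseteq> C" "X \<inter> C = {}" for X Y C :: "nat set"
        using that by blast
      have in_V: "u ` slot w k \<subseteq> V" "v ` slot w k \<subseteq> V"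
        using image_mono[OF sub[OF k], of u] image_mono[OF sub[OF k], of v] by (simp_all only: img)
      have avoid: "fst ` R \<inter> u ` {w * T<..w * T + T} = {}" "snd ` R \<inter> v ` {w * T<..w * T + T} = {}"
        using True by (simp_all add: good_def)
      note Diff[OF in_V(1) image_mono[OF slot[OF k]] avoid(1)] Diff[OF in_V(2) image_mono[OF slot[OF k]] avoid(2)]
      with cards show "u ` slot w k \<subseteq> V - fst ` R \<and> card (u ` slot w k) = s"
        "v ` slot w k \<subseteq> V - snd ` R \<and> card (v ` slot w k) = s" by (simp_all only: simp_thms)
    next
      have "f ` slot w k \<inter> f ` slot w l = {}"
        if "inj_on f {1..n}" "k < B" "l < B" "k \<noteq> l" for f :: "nat \<Rightarrow> nat" and k l
        using disj[OF that(4)] inj_on_image_Int[OF that(1) sub[OF that(2)] sub[OF that(3)]] by simp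
      then show "disjoint_family_on (\<lambda>k. u ` slot w k) {..<B}" "disjoint_family_on (\<lambda>k. v ` slot w k) {..<B}"
        using inj by (auto simp: disjoint_family_on_def)
    qed (rule s)
    also have "2 ^ card R \<le> (2::real) powr \<rho>"
      using True by (simp add: good_def powr_realpow[symmetric])
    then have "(2 ^ card R / (real s)\<^sup>2) ^ B \<le> (2 powr \<rho> / (real s)\<^sup>2) ^ B"
      by (intro power_mono divide_right_mono) auto
    finally show ?thesis using True by (simp add: Ev_def \<mu>_def)
  qed (simp add: Ev_def)

  have bad: "\<exists>w<M. \<exists>R\<in>\<R>. x \<in> Ev (w, R)"
    if small: "real (card (verts (fst (greedy n (graph_of V (fst x)) (graph_of V (snd x)) u v)))) < \<rho>"
    for x
  proof -
    interpret greedy_run n V V "graph_of V (fst x)" "graph_of V (snd x)" u v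
      using u v by unfold_locales (auto simp: simple_graph_of V_def)
    obtain H1 H2 \<pi> where g: "greedy n (graph_of V (fst x)) (graph_of V (snd x)) u v = (H1, H2, \<pi>)"
      by (metis prod.exhaust)
    have m: "real (matched n) < \<rho>"
      using small greedy_size[OF g] by (simp add: g)
    then have "matched n < M" using M by linarith
    moreover have "M * T \<le> n" using n by (simp add: T_def)
    ultimately obtain w R where w: "w < M" and R: "R \<subseteq> V \<times> V" "card R \<le> matched n"
      "inj_on fst R" "inj_on snd R"
      "fst ` R \<inter> u ` {w * T<..w * T + T} = {}" "snd ` R \<inter> v ` {w * T<..w * T + T} = {}"
      and no: "\<And>i j. i \<in> {w * T<..w * T + T} \<Longrightarrow> j \<in> {w * T<..w * T + T} \<Longrightarrow>
      \<not> (\<forall>r\<in>R. adj (graph_of V (fst x)) (u i) (fst r) = adj (graph_of V (snd x)) (v j) (snd r))"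
      by (rule idle_window) blast
    have good: "good w R" using R m by (auto simp: good_def)
    have "\<not> agree R (u i) (v j) (fst x) (snd x)"
      if ij: "i \<in> {w * T<..w * T + T}" "j \<in> {w * T<..w * T + T}" for i j
    proof -
      have "i \<in> {1..n}" "j \<in> {1..n}" by (rule subsetD[OF window[OF w]], fact ij)+
      then have uv: "u i \<in> V" "v j \<in> V" using imageI[of i _ u] imageI[of j _ v] by (metis img)+
      \<comment> \<open>An edge indicator describes adjacency only for distinct vertices; they are
        distinct here because \<open>R\<close> avoids the vertices of the window.\<close>
      have "adj (graph_of V (fst x)) (u i) (fst r) = fst x {u i, fst r}"
        "adj (graph_of V (snd x)) (v j) (snd r) = snd x {v j, snd r}" if "r \<in> R" for r
      proof -
        have "r \<in> V \<times> V" using R(1) that by (rule subsetD)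
        moreover have "fst r \<in> fst ` R" "snd r \<in> snd ` R" using that by simp_all
        then have "fst r \<noteq> u i" "snd r \<noteq> v j" using R(5,6) ij by (metis (no_types) disjoint_iff imageI)+
        ultimately show "adj (graph_of V (fst x)) (u i) (fst r) = fst x {u i, fst r}"
          "adj (graph_of V (snd x)) (v j) (snd r) = snd x {v j, snd r}"
          using uv by (simp_all add: adj_graph_of mem_Times_iff)
      qed
      then show ?thesis using no[OF ij] by (auto simp: agree_def)
    qed
    then have "\<not> agree R a b (fst x) (snd x)"
      if "k < B" "a \<in> u ` slot w k" "b \<in> v ` slot w k" for a b k
      using that(2,3) subsetD[OF slot[OF that(1), of w]] by auto
    then have "x \<in> Ev (w, R)" using good by (auto simp: Ev_def)
    moreover have "R \<in> \<R>" using R \<open>matched n < M\<close> by (auto simp: \<R>_def)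
    ultimately show ?thesis using w by blast
  qed

  have "measure_pmf.prob (pair_pmf (erdos_renyi n (1/2)) (erdos_renyi n (1/2)))
      {(G1, G2). real (card (verts (fst (greedy n G1 G2 u v)))) < \<rho>}
    = measure_pmf.prob \<mu> {x. real (card (verts (fst
        (greedy n (graph_of V (fst x)) (graph_of V (snd x)) u v)))) < \<rho>}"
    unfolding erdos_renyi_half map_pair[symmetric]
    by (simp add: \<mu>_def V_def case_prod_unfold vimage_def)
  also have "\<dots> \<le> measure_pmf.prob \<mu> (\<Union>p\<in>{..<M} \<times> \<R>. Ev p)"
    using bad by (intro measure_pmf.finite_measure_mono) fastforce+
  also have "\<dots> \<le> (\<Sum>p\<in>{..<M} \<times> \<R>. measure_pmf.prob \<mu> (Ev p))"
    using \<R> by (intro measure_pmf.finite_measure_subadditive_finite) auto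
  also have "\<dots> \<le> (\<Sum>p\<in>{..<M} \<times> \<R>. (2 powr \<rho> / (real s)\<^sup>2) ^ B)"
    using Ev_le by (intro sum_mono) auto
  also have "\<dots> = real M * real (card \<R>) * (2 powr \<rho> / (real s)\<^sup>2) ^ B"
    by (simp add: card_cartesian_product)
  also have "\<dots> \<le> real M * (real M * (real n ^ 2) ^ M) * (2 powr \<rho> / (real s)\<^sup>2) ^ B"
  proof -
    have "real (card \<R>) \<le> real (M * (n ^ 2) ^ M)" using \<R>(2) by (rule of_nat_mono)
    then show ?thesis by (intro mult_right_mono mult_left_mono) auto
  qed
  finally show ?thesis .
qed

text \<open>The parameters are \<open>M\<close> about 2 log_2 n, \<open>B\<close> about 2 n^(eps/4)
  and \<open>s\<close> about n/(M B). A block then fails with probability at most 1/e, and half of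
  the exponent gained from the \<open>B\<close> blocks pays for the union bound.\<close>

lemma eventually_greedy_bound:
  assumes \<epsilon>: "0 < \<epsilon>" "\<epsilon> < (2::real)"
  shows "\<forall>\<^sub>F n in sequentially. \<exists>M B s. (2 - \<epsilon>) * log 2 (real n) \<le> real M \<and> n > 0 \<and>
     M * (B * s) \<le> n \<and> s > 0 \<and>
     real M * (real M * (real n ^ 2) ^ M) * (2 powr ((2 - \<epsilon>) * log 2 (real n)) / (real s)\<^sup>2) ^ B
       \<le> exp (- (real n powr (\<epsilon> / 4)))"
proof -
  \<comment> \<open>The right side grows like n^(1 - eps/4) / log n; the subtracted 1 absorbs the
    rounding in \<open>s\<close>.\<close>
  have 1: "\<forall>\<^sub>F n in sequentially. 2 * real n powr (1 - \<epsilon> / 2)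
      \<le> real n / ((2 * log 2 (real n) + 1) * (2 * real n powr (\<epsilon> / 4) + 1)) - 1"
    using \<epsilon> by real_asymp
  \<comment> \<open>The left side is the logarithm of M^2 n^(2M) at the upper bound 2 log_2 n + 1
    for \<open>M\<close>, hence polylogarithmic.\<close>
  have 2: "\<forall>\<^sub>F n in sequentially. 2 * ln (2 * log 2 (real n) + 1) +
      2 * (2 * log 2 (real n) + 1) * ln (real n) \<le> real n powr (\<epsilon> / 4)"
    using \<epsilon> by real_asymp
  show ?thesis
    using 1 2 eventually_ge_at_top[of 2]
  proof eventually_elim
    case (elim n)
    define x where "x = real n powr (\<epsilon> / 4)"
    define M where "M = nat \<lceil>2 * log 2 (real n)\<rceil>"
    define B where "B = nat \<lceil>2 * x\<rceil>"
    define s where "s = n div (M * B)"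
    have x: "x > 0" using elim(3) by (simp add: x_def)
    have log: "log 2 (real n) \<ge> 1" using elim(3) by simp
    have M: "2 * log 2 (real n) \<le> real M" "real M \<le> 2 * log 2 (real n) + 1"
      using log unfolding M_def by linarith+
    have B: "2 * x \<le> real B" "real B \<le> 2 * x + 1"
      using x unfolding B_def by linarith+
    have MB: "real M > 0" "real B > 0" using M B log x by linarith+
    have "2 * real n powr (1 - \<epsilon> / 2) \<le> real n / ((2 * log 2 (real n) + 1) * (2 * x + 1)) - 1"
      using elim(1) by (simp add: x_def)
    also have "\<dots> \<le> real n / (real M * real B) - 1"
      using MB M B log x by (intro diff_right_mono divide_left_mono mult_mono mult_pos_pos) auto
    also have "\<dots> \<le> real s"
      using floor_divide_of_nat_eq[of n "M * B", where ?'a = real]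
        real_of_int_floor_gt_diff_one[of "real n / real (M * B)"]
      unfolding s_def by simp
    finally have s: "2 * real n powr (1 - \<epsilon> / 2) \<le> real s" .
    moreover have pos: "real n powr (1 - \<epsilon> / 2) > 0" using elim(3) by simp
    ultimately have s0: "real s > 0" by linarith
    have "4 * real n powr (2 - \<epsilon>) = (2 * real n powr (1 - \<epsilon> / 2))\<^sup>2"
      by (simp add: power2_eq_square powr_add[symmetric])
    also have "\<dots> \<le> (real s)\<^sup>2" using s pos by (intro power_mono) auto
    finally have s2: "4 * real n powr (2 - \<epsilon>) \<le> (real s)\<^sup>2" .
    have "2 powr ((2 - \<epsilon>) * log 2 (real n)) = real n powr (2 - \<epsilon>)"
      using elim(3) by (simp add: mult.commute[of "2 - \<epsilon>"] powr_powr[symmetric])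
    then have "2 powr ((2 - \<epsilon>) * log 2 (real n)) / (real s)\<^sup>2 \<le> 1 / 4"
      using s2 s0 by (simp add: field_simps)
    \<comment> \<open>This uses exp 1 <= 3 < 4; the 4 is the square of the factor 2 in the lower
      bound for \<open>s\<close>.\<close>
    also have "\<dots> \<le> exp (-1::real)"
      using exp_le by (simp add: exp_minus field_simps)
    finally have q: "2 powr ((2 - \<epsilon>) * log 2 (real n)) / (real s)\<^sup>2 \<le> exp (-1)" .
    have "(2 powr ((2 - \<epsilon>) * log 2 (real n)) / (real s)\<^sup>2) ^ B \<le> exp (-1) ^ B"
      by (intro power_mono q) auto
    also have "\<dots> = exp (- real B)" by (simp add: exp_of_nat_mult[symmetric])
    also have "\<dots> \<le> exp (- (2 * x))" using B by simp
    finally have qB: "(2 powr ((2 - \<epsilon>) * log 2 (real n)) / (real s)\<^sup>2) ^ B \<le> exp (- (2 * x))" .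
    have "real M * (real M * (real n ^ 2) ^ M) = exp (2 * ln (real M) + 2 * real M * ln (real n))"
      using MB elim(3)
      by (simp add: exp_add power2_eq_square power_mult_distrib exp_of_nat_mult mult.assoc exp_double
          flip: power_mult)
    also have "\<dots> \<le> exp x"
    proof -
      have "ln (real M) \<le> ln (2 * log 2 (real n) + 1)" using M MB by simp
      moreover have "2 * real M * ln (real n) \<le> 2 * (2 * log 2 (real n) + 1) * ln (real n)"
        using M elim(3) by (intro mult_right_mono) auto
      ultimately show ?thesis using elim(2) by (simp add: x_def)
    qed
    finally have MM: "real M * (real M * (real n ^ 2) ^ M) \<le> exp x" .
    have "real M * (real M * (real n ^ 2) ^ M) * (2 powr ((2 - \<epsilon>) * log 2 (real n)) / (real s)\<^sup>2) ^ B
        \<le> exp x * exp (- (2 * x))"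
      by (intro mult_mono MM qB) auto
    also have "\<dots> = exp (- x)" by (simp flip: exp_add)
    finally have "real M * (real M * (real n ^ 2) ^ M) *
        (2 powr ((2 - \<epsilon>) * log 2 (real n)) / (real s)\<^sup>2) ^ B \<le> exp (- x)" .
    moreover have "(2 - \<epsilon>) * log 2 (real n) \<le> real M"
      using M(1) log \<epsilon> mult_right_mono[of "2 - \<epsilon>" 2 "log 2 (real n)"] by linarith
    moreover have "M * (B * s) \<le> n"
      by (simp add: s_def mult.assoc[symmetric])
    ultimately show ?case
      using elim(3) s0 unfolding x_def by (intro exI[of _ M] exI[of _ B] exI[of _ s]) auto
  qed
qed

text \<open>The orderings are fixed before the graphs are drawn, and the bound on \<open>n\<close>
  is uniform over them.\<close>

theorem theorem1p3:
  "(\<forall>(n::nat) (G1::nat sgraph) (G2::nat sgraph) u v H1 H2 \<pi>.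
      simple_graph_on {1..n} G1 \<longrightarrow> simple_graph_on {1..n} G2 \<longrightarrow>
      vertex_ordering n {1..n} u \<longrightarrow> vertex_ordering n {1..n} v \<longrightarrow>
      greedy n G1 G2 u v = (H1, H2, \<pi>) \<longrightarrow>
        lcis_solution G1 G2 H1 H2 \<and>
        dom \<pi> = verts H1 \<and> graph_iso (\<lambda>x. the (\<pi> x)) H1 H2 \<and>
        card (verts H1) = card (verts H2)) \<and>
   (\<forall>\<epsilon>::real. \<epsilon> > 0 \<longrightarrow>
      (\<forall>\<^sub>F n in sequentially. \<forall>u v.
         vertex_ordering n {1..n} u \<longrightarrow> vertex_ordering n {1..n} v \<longrightarrow>
           measure_pmf.prob (pair_pmf (erdos_renyi n (1/2)) (erdos_renyi n (1/2)))
             {(G1, G2). case greedy n G1 G2 u v of (H1, H2, \<pi>) \<Rightarrow>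
                real (card (verts H1)) \<ge> (2 - \<epsilon>) * log 2 (real n)}
           \<ge> 1 - exp (- (real n powr (\<epsilon> / 4)))))"
proof (intro conjI allI impI)
  fix n :: nat and G1 G2 :: "nat sgraph" and u v H1 H2 \<pi>
  assume *: "simple_graph_on {1..n} G1" "simple_graph_on {1..n} G2"
    "vertex_ordering n {1..n} u" "vertex_ordering n {1..n} v"
    "greedy n G1 G2 u v = (H1, H2, \<pi>)"
  interpret greedy_run n "{1..n}" "{1..n}" G1 G2 u v
    using * by unfold_locales
  show "lcis_solution G1 G2 H1 H2" "dom \<pi> = verts H1" "graph_iso (\<lambda>x. the (\<pi> x)) H1 H2"
    "card (verts H1) = card (verts H2)"
    using greedy_correct[OF *(5)] by simp_all
next
  fix \<epsilon> :: real assume \<epsilon>: "\<epsilon> > 0"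
  define large small
    where "large n u v = {(G1, G2). case greedy n G1 G2 u v of (H1, H2, \<pi>) \<Rightarrow>
              real (card (verts H1)) \<ge> (2 - \<epsilon>) * log 2 (real n)}"
      and "small n u v = {(G1, G2). real (card (verts (fst (greedy n G1 G2 u v)))) < (2 - \<epsilon>) * log 2 (real n)}"
    for n and u v :: "nat \<Rightarrow> nat"
  have large: "large n u v = UNIV - small n u v" for n u v
    by (auto simp: large_def small_def case_prod_unfold)
  have "\<forall>\<^sub>F n in sequentially. \<forall>u v.
         vertex_ordering n {1..n} u \<longrightarrow> vertex_ordering n {1..n} v \<longrightarrow>
           measure_pmf.prob (pair_pmf (erdos_renyi n (1/2)) (erdos_renyi n (1/2))) (small n u v)
           \<le> exp (- (real n powr (\<epsilon> / 4)))"
  proof (cases "\<epsilon> < 2")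
    case True
    show ?thesis
      using eventually_greedy_bound[OF \<epsilon> True]
    proof eventually_elim
      case (elim n)
      then obtain M B s where *: "(2 - \<epsilon>) * log 2 (real n) \<le> real M" "n > 0" "M * (B * s) \<le> n" "s > 0"
        and bound: "real M * (real M * (real n ^ 2) ^ M) *
          (2 powr ((2 - \<epsilon>) * log 2 (real n)) / (real s)\<^sup>2) ^ B \<le> exp (- (real n powr (\<epsilon> / 4)))"
        by blast
      show ?case
        unfolding small_def using order_trans[OF prob_greedy_small[OF _ _ *] bound] by blast
    qed
  next
    case False
    show ?thesis
      using eventually_ge_at_top[of 1]
    proof eventually_elim
      case (elim n)
      \<comment> \<open>For eps >= 2 the threshold is nonpositive as soon as n >= 1, so no output
        falls below it.\<close>
      then have "(2 - \<epsilon>) * log 2 (real n) \<le> 0"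
        using False by (intro mult_nonpos_nonneg) auto
      then have "small n u v = {}" for u v
        by (auto simp: small_def intro: order_trans)
      then show ?case by simp
    qed
  qed
  then show "\<forall>\<^sub>F n in sequentially. \<forall>u v.
         vertex_ordering n {1..n} u \<longrightarrow> vertex_ordering n {1..n} v \<longrightarrow>
           measure_pmf.prob (pair_pmf (erdos_renyi n (1/2)) (erdos_renyi n (1/2)))
             {(G1, G2). case greedy n G1 G2 u v of (H1, H2, \<pi>) \<Rightarrow>
                real (card (verts H1)) \<ge> (2 - \<epsilon>) * log 2 (real n)}
           \<ge> 1 - exp (- (real n powr (\<epsilon> / 4)))"
    unfolding large_def[symmetric] large
    by eventually_elim (simp add: measure_pmf.prob_compl[simplified])
qed

end
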